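(* Let $n\geq 2$ and let $K$ be a convex body contained in the interior of the unit ball of $\mathbb{R}^n$ centred at the origin. Suppose that for every unit vector $x\in\mathbb{S}^{n-1}$ the set $S(K,x)\cap S(K,-x)$ is contained in the subspace $x^{\bot}$. Then $K$ is a Euclidean ball.
   Context: A convex body is a compact convex set with non-empty interior. For a convex body $K\subset\mathbb{R}^n$ and a point $x\in\mathbb{R}^n\setminus K$, the cone generated by $K$ with apex $x$ is $C(K,x)=\{x+\lambda(y-x): y\in K,\ \lambda\geq 0\}$, and the support cone $S(K,x)$ is the boundary of $C(K,x)$. $x^{\bot}$ denotes the hyperplane through the origin orthogonal to $x$. *)

theory Defs
  imports "HOL-Analysis.Analysis"
begin

definition convex_body :: "'a::euclidean_space set \<Rightarrow> bool" where
  "convex_body K \<longleftrightarrow> compact K \<and> convex K \<and> interior K \<noteq> {}"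

definition generated_cone :: "'a::euclidean_space set \<Rightarrow> 'a \<Rightarrow> 'a set" where
  "generated_cone K x = {x + l *\<^sub>R (y - x) | l y. y \<in> K \<and> l \<ge> 0}"

(* Only meaningful for an apex x outside K; the definitions are total. *)
definition support_cone :: "'a::euclidean_space set \<Rightarrow> 'a \<Rightarrow> 'a set" where
  "support_cone K x = frontier (generated_cone K x)"

end

theory Submission
  imports Defs
begin

text \<open>
  In a plane \<open>P\<close> spanned by orthonormal \<open>x, e\<close>, let \<open>A\<close> be the extremal slope \<open>(e \<bullet> y) / (1 - x \<bullet> y)\<close> of
  \<open>K \<inter> P\<close> seen from \<open>x\<close>, and \<open>B\<close> an extremal slope seen from \<open>- x\<close>. The corresponding rays lie in the
  two support cones and meet on \<open>x\<^sup>\<bottom>\<close> only if \<open>A = B\<close>. If the origin were not interior to \<open>K\<close>, this would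
  make the maximal and minimal slopes from \<open>- x\<close> coincide for a suitable \<open>x\<close>. Otherwise it says that the
  support function \<open>h\<close> of \<open>K \<inter> P\<close>, as a function of the angle, satisfies
  \<open>h (t + (pi - 2 * arccos (h t))) = h t\<close>: the tangent at angle \<open>t\<close> meets the unit circle in the point
  of angle \<open>t - arccos (h t)\<close>, which plays the role of \<open>x\<close>. The rotation angle does not change along
  an orbit, so if \<open>h\<close> were not constant, the intermediate value theorem would give an irrational orbit,
  which is dense, and \<open>h\<close> is constant on its closure. Hence every planar section through the origin is a
  disc about the origin, and any two of these discs have the same radius because any two directions
  lie in a common plane.
\<close>

section \<open>Supporting rays in planar sections\<close>

text \<open>The quotient bound is cleared of its denominator: for orthonormal \<open>x\<close>,
  \<open>e\<close> it is a half-plane bounded by the line through \<open>x\<close> with direction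
  \<open>A *\<^sub>R e - x\<close>. The condition \<open>x \<bullet> p < 1\<close> puts the contact
  point \<open>p\<close> on the ray itself, off the apex.\<close>

definition supporting_slope :: "'a::euclidean_space set \<Rightarrow> 'a \<Rightarrow> 'a \<Rightarrow> real \<Rightarrow> bool" where
  "supporting_slope K x e A \<longleftrightarrow>
     (\<exists>p \<in> K \<inter> span {x, e}. x \<bullet> p < 1 \<and> e \<bullet> p = A * (1 - x \<bullet> p)) \<and>
     (\<forall>y \<in> K \<inter> span {x, e}. e \<bullet> y \<le> A * (1 - x \<bullet> y))"

lemma span_pair_eqs:
  fixes x e :: "'a::real_vector"
  shows "span {- x, e} = span {x, e}" and "span {x, - e} = span {x, e}"
proof -
  have "- x \<in> span {x, e}" "- e \<in> span {x, e}" "x \<in> span {- x, e}" "e \<in> span {x, - e}"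
    using span_neg[of "- x" "{- x, e}"] span_neg[of "- e" "{x, - e}"]
    by (auto intro: span_neg span_base)
  then show "span {- x, e} = span {x, e}" "span {x, - e} = span {x, e}"
    by (auto simp: span_eq intro: span_base)
qed

lemma orthonormal_pair_expansion:
  fixes x e :: "'a::real_inner"
  assumes "norm x = 1" "norm e = 1" "x \<bullet> e = 0" "y \<in> span {x, e}"
  shows "y = (x \<bullet> y) *\<^sub>R x + (e \<bullet> y) *\<^sub>R e"
proof -
  obtain a b where y: "y = a *\<^sub>R x + b *\<^sub>R e"
    using assms(4) by (auto simp: span_insert algebra_simps eq_diff_eq)
  have "x \<bullet> y = a" "e \<bullet> y = b"
    using assms(1-3) by (auto simp: y inner_add_right inner_commute[of e x] dot_square_norm)
  with y show ?thesis by simp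
qed

text \<open>The ray runs through the contact point, hence inside the cone; a shift off it in
  direction \<open>e\<close> gives a slope larger than any in the section, hence leaves the
  cone.\<close>

lemma supporting_ray_in_support_cone:
  fixes x e :: "'a::euclidean_space"
  assumes on: "norm x = 1" "norm e = 1" "x \<bullet> e = 0"
    and A: "supporting_slope K x e A" and "r \<ge> 0"
  shows "x + r *\<^sub>R (A *\<^sub>R e - x) \<in> support_cone K x"
proof -
  define z where "z = x + r *\<^sub>R (A *\<^sub>R e - x)"
  have xx: "x \<bullet> x = 1" "e \<bullet> e = 1" "e \<bullet> x = 0"
    using on by (auto simp: dot_square_norm inner_commute)
  obtain p where p: "p \<in> K" "p \<in> span {x, e}" "x \<bullet> p < 1" "e \<bullet> p = A * (1 - x \<bullet> p)"
    using A by (auto simp: supporting_slope_def)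
  have "p = (x \<bullet> p) *\<^sub>R x + (A * (1 - x \<bullet> p)) *\<^sub>R e"
    using orthonormal_pair_expansion[OF on p(2)] p(4) by simp
  then have px: "p - x = (1 - x \<bullet> p) *\<^sub>R (A *\<^sub>R e - x)"
    by (simp add: algebra_simps)
  have "z = x + (r / (1 - x \<bullet> p)) *\<^sub>R (p - x)"
    unfolding px using p(3) by (simp add: z_def)
  then have "z \<in> generated_cone K x"
    unfolding generated_cone_def using p \<open>r \<ge> 0\<close> by (intro CollectI exI[of _ "r / (1 - x \<bullet> p)"] exI[of _ p]) auto
  moreover have "z \<notin> interior (generated_cone K x)"
  proof
    assume "z \<in> interior (generated_cone K x)"
    then obtain d where d: "d > 0" "ball z d \<subseteq> generated_cone K x"
      by (auto simp: mem_interior)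
    have "z + (d / 2) *\<^sub>R e \<in> ball z d"
      using d(1) on by (simp add: dist_norm)
    with d obtain l y where y: "z + (d / 2) *\<^sub>R e = x + l *\<^sub>R (y - x)" "y \<in> K" "l \<ge> 0"
      by (auto simp: generated_cone_def)
    from y(1) have eq: "l *\<^sub>R (y - x) = (- r) *\<^sub>R x + (r * A + d / 2) *\<^sub>R e"
      by (simp add: z_def algebra_simps)
    have 1: "l * (x \<bullet> y - 1) = - r"
      using arg_cong[OF eq, of "\<lambda>v. x \<bullet> v"] on xx by (simp add: inner_diff_right inner_add_right)
    have 2: "l * (e \<bullet> y) = r * A + d / 2"
      using arg_cong[OF eq, of "\<lambda>v. e \<bullet> v"] on xx by (simp add: inner_diff_right inner_add_right)
    \<comment> \<open>\<open>l = 0\<close> would force \<open>r = 0\<close> and then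
      \<open>d = 0\<close>. Dividing by \<open>l\<close> shows that \<open>y\<close> lies in the
      plane, where the slope bound applies.\<close>
    have "l \<noteq> 0" using 1 2 d(1) by auto
    then have "y = x + (1 / l) *\<^sub>R (l *\<^sub>R (y - x))" by simp
    also have "\<dots> \<in> span {x, e}"
      unfolding eq by (intro span_add span_scale span_base) auto
    finally have "e \<bullet> y \<le> A * (1 - x \<bullet> y)"
      using A y(2) by (auto simp: supporting_slope_def)
    then have "l * (e \<bullet> y) \<le> l * (A * (1 - x \<bullet> y))"
      using y(3) by (rule mult_left_mono)
    also have "\<dots> = A * - (l * (x \<bullet> y - 1))" by (simp add: algebra_simps)
    finally show False unfolding 1 2 using d(1) by simp
  qed
  ultimately show ?thesis
    unfolding z_def[symmetric] support_cone_def frontier_def using closure_subset by auto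
qed

lemma supporting_slope_exists:
  fixes x e :: "'a::euclidean_space"
  assumes "compact K" "K \<subseteq> ball 0 1" "norm x = 1" "K \<inter> span {x, e} \<noteq> {}"
  shows "\<exists>A. supporting_slope K x e A"
proof -
  have lt: "x \<bullet> y < 1" if "y \<in> K" for y
    using that assms(2,3) norm_cauchy_schwarz[of x y] by (force simp: subset_iff)
  have "compact (K \<inter> span {x, e})"
    by (intro compact_Int_closed assms closed_span)
  moreover have "continuous_on (K \<inter> span {x, e}) (\<lambda>y. (e \<bullet> y) / (1 - x \<bullet> y))"
    using lt by (intro continuous_intros) force
  ultimately obtain p where p: "p \<in> K \<inter> span {x, e}"
    "\<And>y. y \<in> K \<inter> span {x, e} \<Longrightarrow> (e \<bullet> y) / (1 - x \<bullet> y) \<le> (e \<bullet> p) / (1 - x \<bullet> p)"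
    using continuous_attains_sup[OF _ assms(4)] by blast
  have "supporting_slope K x e ((e \<bullet> p) / (1 - x \<bullet> p))"
    unfolding supporting_slope_def
  proof (intro conjI ballI bexI)
    show "x \<bullet> p < 1" using lt p(1) by auto
    then show "e \<bullet> p = e \<bullet> p / (1 - x \<bullet> p) * (1 - x \<bullet> p)" by simp
    show "p \<in> K \<inter> span {x, e}" by fact
    fix y assume y: "y \<in> K \<inter> span {x, e}"
    with lt have "x \<bullet> y < 1" by auto
    with p(2)[OF y] show "e \<bullet> y \<le> e \<bullet> p / (1 - x \<bullet> p) * (1 - x \<bullet> y)"
      using \<open>x \<bullet> p < 1\<close> by (simp add: field_simps)
  qed
  then show ?thesis ..
qed

text \<open>The second alternative for \<open>B\<close> says that \<open>B\<close> is the smallest slope at \<open>- x\<close>.\<close>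

lemma supporting_slopes_eq:
  fixes x e :: "'a::euclidean_space"
  assumes on: "norm x = 1" "norm e = 1" "x \<bullet> e = 0"
    and perp: "support_cone K x \<inter> support_cone K (- x) \<subseteq> {y. x \<bullet> y = 0}"
    and A: "supporting_slope K x e A"
    and B: "supporting_slope K (- x) e B \<or> supporting_slope K (- x) (- e) (- B)"
    and pos: "A \<ge> 0" "B \<ge> 0" "A + B > 0"
  shows "A = B"
proof -
  \<comment> \<open>The rays \<open>x + r (A e - x)\<close> and \<open>- x + s (B e + x)\<close>
    meet when \<open>r A = s B\<close> and \<open>r + s = 2\<close>; this is the solution. The
    meeting point has \<open>x\<close>-coordinate \<open>1 - r\<close>, so it is orthogonal to
    \<open>x\<close> only if \<open>r = s = 1\<close>.\<close>
  define r s where "r = 2 * B / (A + B)" and "s = 2 * A / (A + B)"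
  have rs: "r \<ge> 0" "s \<ge> 0" "r * A = s * B" "r + s = 2"
    using pos by (simp_all add: r_def s_def) (simp add: divide_simps)
  define z where "z = x + r *\<^sub>R (A *\<^sub>R e - x)"
  have "z = (1 - r) *\<^sub>R x + (r * A) *\<^sub>R e" by (simp add: z_def algebra_simps)
  also have "1 - r = s - 1" using rs(4) by simp
  finally have zB: "z = - x + s *\<^sub>R (B *\<^sub>R e - - x)"
    unfolding rs(3) by (simp add: algebra_simps)
  have "z \<in> support_cone K x"
    unfolding z_def using on A rs(1) by (rule supporting_ray_in_support_cone)
  moreover have "z \<in> support_cone K (- x)"
    using B
  proof
    assume "supporting_slope K (- x) e B"
    then show ?thesis
      unfolding zB using on rs(2) by (intro supporting_ray_in_support_cone) auto
  next
    assume "supporting_slope K (- x) (- e) (- B)"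
    then have "- x + s *\<^sub>R ((- B) *\<^sub>R (- e) - - x) \<in> support_cone K (- x)"
      using on rs(2) by (intro supporting_ray_in_support_cone) auto
    then show ?thesis by (simp add: zB)
  qed
  ultimately have "x \<bullet> z = 0" using perp by auto
  then have "r = 1"
    using on by (simp add: z_def inner_add_right inner_diff_right dot_square_norm)
  with rs pos show ?thesis by simp
qed

text \<open>Gram-Schmidt; if \<open>v\<close> is parallel to \<open>u\<close>, any unit vector
  orthogonal to \<open>u\<close> serves, and dimension at least 2 provides one.\<close>

lemma orthonormal_partner_exists:
  fixes u v :: "'a::euclidean_space"
  assumes "DIM('a) \<ge> 2" "norm u = 1"
  obtains w where "norm w = 1" "u \<bullet> w = 0" "v \<in> span {u, w}"
proof -
  have u: "u \<bullet> u = 1" using assms(2) by (simp add: dot_square_norm)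
  define w0 where "w0 = v - (u \<bullet> v) *\<^sub>R u"
  show thesis
  proof (cases "w0 = 0")
    case True
    obtain z where z: "z \<noteq> 0" "orthogonal u z"
      using orthogonal_to_vector_exists[OF assms(1), of u] by blast
    have "v = (u \<bullet> v) *\<^sub>R u" using True by (simp add: w0_def)
    then have "v \<in> span {u, sgn z}" by (metis span_base span_scale insertI1)
    with z show thesis
      by (intro that[of "sgn z"]) (auto simp: norm_sgn sgn_div_norm orthogonal_def inner_commute)
  next
    case False
    have "v = (u \<bullet> v) *\<^sub>R u + norm w0 *\<^sub>R sgn w0"
      using False by (simp add: sgn_div_norm w0_def)
    also have "\<dots> \<in> span {u, sgn w0}" by (intro span_add span_scale span_base) auto
    finally have "v \<in> span {u, sgn w0}" .
    moreover have "u \<bullet> w0 = 0" using u by (simp add: w0_def inner_diff_right)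
    ultimately show thesis
      using False by (intro that[of "sgn w0"]) (auto simp: norm_sgn sgn_div_norm)
  qed
qed

section \<open>The origin is an interior point\<close>

text \<open>Otherwise a hyperplane through the origin has \<open>K\<close> on one side. For
  \<open>x\<close> in it, all slopes from \<open>x\<close> and \<open>- x\<close> are nonnegative,
  so the largest and the smallest slope from \<open>- x\<close> both equal the largest from
  \<open>x\<close>, and a planar section with interior points would lie on a line.\<close>

lemma zero_in_interior:
  fixes K :: "'a::euclidean_space set"
  assumes dim: "DIM('a) \<ge> 2" and K: "convex_body K" "K \<subseteq> ball 0 1"
    and perp: "\<And>x. norm x = 1 \<Longrightarrow> support_cone K x \<inter> support_cone K (- x) \<subseteq> {y. x \<bullet> y = 0}"
  shows "0 \<in> interior K"
proof (rule ccontr)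
  assume "0 \<notin> interior K"
  have cK: "compact K" "convex K" "interior K \<noteq> {}" using K by (auto simp: convex_body_def)
  obtain a where a: "a \<noteq> 0" "\<And>y. y \<in> interior K \<Longrightarrow> 0 \<le> a \<bullet> y"
    using separating_hyperplane_set_0[OF convex_interior[OF cK(2)] \<open>0 \<notin> interior K\<close>] by blast
  have aK: "0 \<le> a \<bullet> y" if "y \<in> K" for y
  proof -
    have "y \<in> closure (interior K)"
      using that cK by (simp add: convex_closure_interior closure_subset[THEN subsetD])
    moreover have "closure (interior K) \<subseteq> {y. a \<bullet> y \<ge> 0}"
      using a(2) by (intro closure_minimal closed_halfspace_ge) auto
    ultimately show ?thesis by auto
  qed
  obtain x where "norm x = 1" "sgn a \<bullet> x = 0"
    using orthonormal_partner_exists[OF dim, of "sgn a"] a(1) by (auto simp: norm_sgn)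
  with a(1) have x: "norm x = 1" "a \<bullet> x = 0"
    by (auto simp: sgn_div_norm)
  obtain q d where q: "d > 0" "cball q d \<subseteq> K" "q \<in> interior K"
    using cK(3) by (metis all_not_in_conv mem_interior_cball)
  have "a \<bullet> q > 0"
  proof -
    have "q - (d / norm a) *\<^sub>R a \<in> K"
      using q a(1) by (intro subsetD[OF q(2)]) (simp add: dist_norm)
    then have "0 \<le> a \<bullet> q - d / norm a * (a \<bullet> a)"
      using aK[of "q - (d / norm a) *\<^sub>R a"] by (simp add: inner_diff_right)
    moreover have "d / norm a * (a \<bullet> a) > 0" using q(1) a(1) by simp
    ultimately show ?thesis by linarith
  qed
  \<comment> \<open>The part of \<open>q\<close> orthogonal to \<open>x\<close>, so that the plane
    of \<open>x\<close> and \<open>e\<close> passes through the interior point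
    \<open>q\<close>.\<close>
  define w where "w = q - (x \<bullet> q) *\<^sub>R x"
  have xw: "x \<bullet> w = 0" using x by (simp add: w_def inner_diff_right dot_square_norm)
  have aw: "a \<bullet> w > 0" using x \<open>a \<bullet> q > 0\<close> by (simp add: w_def inner_diff_right)
  then have "w \<noteq> 0" by auto
  define e where "e = w /\<^sub>R norm w"
  have on: "norm x = 1" "norm e = 1" "x \<bullet> e = 0"
    using x xw \<open>w \<noteq> 0\<close> by (auto simp: e_def)
  have ee: "e \<bullet> e = 1" using on by (simp add: dot_square_norm)
  have ae: "a \<bullet> e > 0" using aw \<open>w \<noteq> 0\<close> by (simp add: e_def)
  have "q = (x \<bullet> q) *\<^sub>R x + norm w *\<^sub>R e" using \<open>w \<noteq> 0\<close> by (simp add: e_def w_def)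
  also have "\<dots> \<in> span {x, e}" by (intro span_add span_scale span_base) auto
  finally have qP: "q \<in> span {x, e}" .
  have q'P: "q + d *\<^sub>R e \<in> span {x, e}" by (intro span_add qP span_scale span_base) auto
  have q'K: "q + d *\<^sub>R e \<in> K" using q on by (intro subsetD[OF q(2)]) (simp add: dist_norm)
  have qK: "q \<in> K" using q(1,2) by auto
  have up: "e \<bullet> y \<ge> 0" if "y \<in> K" "y \<in> span {x, e}" for y
  proof -
    have "y = (x \<bullet> y) *\<^sub>R x + (e \<bullet> y) *\<^sub>R e" by (rule orthonormal_pair_expansion[OF on that(2)])
    then have "a \<bullet> y = (e \<bullet> y) * (a \<bullet> e)" using x by (metis inner_add_right inner_scaleR_right mult_zero_right add_0)
    with aK[OF that(1)] ae show ?thesis by (simp add: zero_le_mult_iff)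
  qed
  have lt: "x \<bullet> y < 1" "- x \<bullet> y < 1" if "y \<in> K" for y
    using that K(2) x(1) norm_cauchy_schwarz[of x y] norm_cauchy_schwarz[of "- x" y]
    by (force simp: subset_iff)+
  have ne: "K \<inter> span {x, e} \<noteq> {}" using qK qP by auto
  obtain M where M: "supporting_slope K x e M"
    using supporting_slope_exists[OF cK(1) K(2) on(1) ne] by blast
  obtain N where N: "supporting_slope K (- x) e N"
    using supporting_slope_exists[OF cK(1) K(2), of "- x" e] on(1) ne by (auto simp: span_pair_eqs)
  obtain L where L: "supporting_slope K (- x) (- e) (- L)"
    using supporting_slope_exists[OF cK(1) K(2), of "- x" "- e"] on(1) ne
    by (auto simp: span_pair_eqs) (metis minus_minus)
  have "e \<bullet> (q + d *\<^sub>R e) > 0" using up[OF qK qP] q(1) ee by (simp add: inner_add_right)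
  moreover have "e \<bullet> (q + d *\<^sub>R e) \<le> M * (1 - x \<bullet> (q + d *\<^sub>R e))"
    "e \<bullet> (q + d *\<^sub>R e) \<le> N * (1 - - x \<bullet> (q + d *\<^sub>R e))"
    using M N q'K q'P by (auto simp: supporting_slope_def span_pair_eqs)
  ultimately have MN: "M > 0" "N > 0"
    using lt[OF q'K] by (smt (verit) mult_nonpos_nonneg)+
  have "L \<ge> 0"
  proof -
    obtain p where p: "p \<in> K" "p \<in> span {x, e}" "- x \<bullet> p < 1" "e \<bullet> p = L * (1 - - x \<bullet> p)"
      using L by (auto simp: supporting_slope_def span_pair_eqs)
    with up[of p] show ?thesis by (simp add: zero_le_mult_iff)
  qed
  have "M = N"
    using supporting_slopes_eq[OF on perp[OF on(1)] M] N MN by simp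
  moreover have "M = L"
    using supporting_slopes_eq[OF on perp[OF on(1)] M] L MN \<open>L \<ge> 0\<close> by simp
  ultimately have "N = L" by simp
  \<comment> \<open>The section is squeezed onto one line through \<open>- x\<close>, but
    \<open>q\<close> and \<open>q + d *\<^sub>R e\<close> have equal \<open>x\<close>-coordinate and
    different \<open>e\<close>-coordinates.\<close>
  have "e \<bullet> y = N * (1 + x \<bullet> y)" if "y \<in> K" "y \<in> span {x, e}" for y
    using N L that \<open>N = L\<close> by (force simp: supporting_slope_def span_pair_eqs)
  from this[OF qK qP] this[OF q'K q'P] show False
    using q(1) on ee by (simp add: inner_add_right)
qed

section \<open>Support functions of planar sections\<close>

text \<open>The step \<open>pi - 2 * arccos (h t)\<close> depends on \<open>t\<close> only through
  \<open>h t\<close>, so each orbit is that of a fixed rotation of the circle. The bounds keep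
  \<open>arccos\<close> continuous and injective on the values of \<open>h\<close>.\<close>

lemma continuous_rotation_invariant_imp_constant:
  fixes h :: "real \<Rightarrow> real"
  assumes cont: "continuous_on UNIV h"
    and per: "\<And>t. h (t + 2 * pi) = h t"
    and bd: "\<And>t. 0 < h t \<and> h t < 1"
    and rot: "\<And>t. h (t + (pi - 2 * arccos (h t))) = h t"
  shows "h s = h t"
proof (rule ccontr)
  assume "h s \<noteq> h t"
  \<comment> \<open>The step measured in full turns, so an irrational value gives a dense
    orbit.\<close>
  define G where "G = (\<lambda>t. (pi - 2 * arccos (h t)) / (2 * pi))"
  have G: "continuous_on UNIV G"
    unfolding G_def
    by (intro continuous_intros cont ballI conjI) (use bd in \<open>force intro: less_imp_le order.trans[of "-1" "0::real"]\<close>)+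
  have "G s \<noteq> G t"
    using \<open>h s \<noteq> h t\<close> bd[of s] bd[of t] by (auto simp: G_def arccos_eq_iff)
  then have "uncountable (open_segment (G s) (G t))"
    by (auto simp: open_segment_eq_real_ivl uncountable_open_interval)
  then have "\<not> open_segment (G s) (G t) \<subseteq> \<rat>"
    using countable_rat countable_subset by blast
  then obtain g where g: "g \<in> open_segment (G s) (G t)" "g \<notin> \<rat>" by blast
  have "connected (range G)"
    using connected_continuous_image[OF G] by simp
  then have "open_segment (G s) (G t) \<subseteq> range G"
    using closed_segment_subset[of "G s" "range G" "G t"] segment_open_subset_closed[of "G s" "G t"]
    by (auto simp flip: is_interval_convex_1 simp: is_interval_connected_1)
  with g obtain u where u: "G u = g" by auto
  have orbit: "h (u + of_nat k * (2 * pi * g)) = h u" for k :: nat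
  proof (induction k)
    case (Suc k)
    define w where "w = u + of_nat k * (2 * pi * g)"
    have "2 * pi * g = pi - 2 * arccos (h w)"
      using Suc by (simp add: w_def u[symmetric] G_def)
    then have "u + of_nat (Suc k) * (2 * pi * g) = w + (pi - 2 * arccos (h w))"
      by (simp only: w_def of_nat_Suc distrib_right mult_1 add_ac)
    then show ?case using rot[of w] Suc by (simp only: w_def)
  qed simp
  interpret periodic_fun_simple h "2 * pi"
    by standard (rule per)
  have "h v = h u" for v
  proof (rule ccontr)
    assume neq: "h v \<noteq> h u"
    have "continuous (at v) h" using cont by (simp add: continuous_on_eq_continuous_at)
    then obtain d where d: "d > 0" "\<And>w. dist w v < d \<Longrightarrow> dist (h w) (h v) < dist (h u) (h v)"
      using neq unfolding continuous_at_eps_delta by (metis zero_less_dist_iff)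
    \<comment> \<open>Density of the fractional parts of the multiples of \<open>g\<close>. Since
      \<open>k > 0\<close>, the approximating point \<open>w\<close> is on the forward orbit up to
      full turns; it is so close to \<open>v\<close> that \<open>h w = h u\<close> contradicts the
      choice of \<open>d\<close>.\<close>
    obtain m k :: int where mk: "k > 0" "\<bar>of_int k * g - of_int m - (v - u) / (2 * pi)\<bar> < d / (2 * pi)"
      using sequence_of_fractional_parts_is_dense[OF g(2), of "d / (2 * pi)" "(v - u) / (2 * pi)"] d(1)
      by (metis divide_pos_pos mult_pos_pos pi_gt_zero zero_less_numeral)
    define w where "w = u + of_nat (nat k) * (2 * pi * g) + of_int (- m) * (2 * pi)"
    have "w - v = 2 * pi * (of_int k * g - of_int m - (v - u) / (2 * pi))"
      using mk(1) by (simp add: w_def field_simps)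
    then have "dist w v = 2 * pi * \<bar>of_int k * g - of_int m - (v - u) / (2 * pi)\<bar>"
      by (simp add: dist_real_def abs_mult)
    also have "\<dots> < d" using mk(2) by (simp add: field_simps)
    finally have "dist (h w) (h v) < dist (h u) (h v)" by (rule d)
    moreover have "h w = h u"
      unfolding w_def using orbit plus_of_int by (metis)
    ultimately show False by simp
  qed
  then show False using \<open>h s \<noteq> h t\<close> by metis
qed

section \<open>Angular parametrisation of the unit circle in a plane\<close>

definition circle_point :: "'a::real_vector \<Rightarrow> 'a \<Rightarrow> real \<Rightarrow> 'a" where
  "circle_point a b t = cos t *\<^sub>R a + sin t *\<^sub>R b"

lemma circle_point_orthonormal:
  fixes a b :: "'a::real_inner"
  assumes "norm a = 1" "norm b = 1" "a \<bullet> b = 0"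
  shows "circle_point a b s \<bullet> circle_point a b t = cos (s - t)"
    and "norm (circle_point a b t) = 1"
proof -
  show *: "circle_point a b s \<bullet> circle_point a b t = cos (s - t)" for s t
    using assms by (simp add: circle_point_def inner_add_left inner_add_right dot_square_norm
      inner_commute[of b a] cos_diff)
  show "norm (circle_point a b t) = 1"
    using *[of t t] by (simp add: norm_eq_sqrt_inner)
qed

text \<open>Passing to a rotated frame only shifts angles, which allows computing in a frame whose
  first vector is the apex \<open>x\<close>.\<close>

lemma circle_point_rotate:
  fixes a b :: "'a::real_vector"
  shows "circle_point (circle_point a b s) (circle_point a b (s + pi / 2)) t = circle_point a b (s + t)"
  by (simp add: circle_point_def cos_add sin_add algebra_simps)

lemma circle_point_in_span:
  fixes a b :: "'a::real_vector"
  shows "circle_point a b t \<in> span {a, b}"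
  unfolding circle_point_def by (intro span_add span_scale span_base) auto

lemma span_circle_points:
  fixes a b :: "'a::real_vector"
  shows "span {circle_point a b t, circle_point a b (t + pi / 2)} = span {a, b}"
proof -
  let ?x = "circle_point a b t" and ?e = "circle_point a b (t + pi / 2)"
  have "a = circle_point ?x ?e (- t)" "b = circle_point ?x ?e (pi / 2 - t)"
    unfolding circle_point_rotate by (simp_all add: circle_point_def)
  then have "a \<in> span {?x, ?e}" "b \<in> span {?x, ?e}"
    by (metis circle_point_in_span)+
  then show ?thesis by (simp add: span_eq circle_point_in_span)
qed

text \<open>Equal slopes at \<open>x\<close> and \<open>- x\<close> make the support function of the
  section invariant under the rotation step, hence constant; a set with constant support function
  about the origin is then shown to be a disc.\<close>

lemma section_is_disc:
  fixes K :: "'a::euclidean_space set"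
  assumes K: "compact K" "K \<subseteq> ball 0 1" "0 \<in> interior K"
    and perp: "\<And>x. norm x = 1 \<Longrightarrow> support_cone K x \<inter> support_cone K (- x) \<subseteq> {y. x \<bullet> y = 0}"
    and ab: "norm a = 1" "norm b = 1" "a \<bullet> b = 0"
  obtains c where "c > 0"
    "\<And>u. norm u = 1 \<Longrightarrow> u \<in> span {a, b} \<Longrightarrow> c *\<^sub>R u \<in> K"
    "\<And>y. y \<in> K \<Longrightarrow> y \<in> span {a, b} \<Longrightarrow> norm y \<le> c"
proof -
  let ?u = "circle_point a b"
  define Q where "Q = K \<inter> span {a, b}"
  note ip = circle_point_orthonormal(1)[OF ab] and nu = circle_point_orthonormal(2)[OF ab]
  have Q: "compact Q" unfolding Q_def by (intro compact_Int_closed K closed_span)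
  obtain d where d: "d > 0" "cball 0 d \<subseteq> K" using K(3) by (auto simp: mem_interior_cball)
  have dQ: "d *\<^sub>R ?u t \<in> Q" for t
    unfolding Q_def using d circle_point_in_span nu by (auto intro!: span_scale subsetD[OF d(2)])
  have "\<exists>p\<in>Q. \<forall>y\<in>Q. ?u t \<bullet> y \<le> ?u t \<bullet> p" for t
    using dQ by (intro continuous_attains_sup Q continuous_intros) auto
  then obtain p where p: "\<And>t. p t \<in> Q" "\<And>t y. y \<in> Q \<Longrightarrow> ?u t \<bullet> y \<le> ?u t \<bullet> p t" by metis
  define h where "h = (\<lambda>t. ?u t \<bullet> p t)"
  have nQ: "norm y < 1" if "y \<in> Q" for y using that K(2) by (auto simp: Q_def)
  have heq: "h t = c" if "\<And>y. y \<in> Q \<Longrightarrow> ?u t \<bullet> y \<le> c" "q \<in> Q" "?u t \<bullet> q = c" for t c q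
    using that(1)[OF p(1)[of t]] p(2)[OF that(2), of t] that(3) by (simp add: h_def)
  have bd: "0 < h t \<and> h t < 1" for t
  proof
    have "0 < ?u t \<bullet> (d *\<^sub>R ?u t)" using d(1) ip[of t t] by simp
    then show "0 < h t" using p(2)[OF dQ, of t t] by (simp add: h_def)
    show "h t < 1"
      using norm_cauchy_schwarz[of "?u t" "p t"] nQ[OF p(1)[of t]] nu by (simp add: h_def)
  qed
  have per: "h (t + 2 * pi) = h t" for t
  proof -
    have "?u (t + 2 * pi) = ?u t" by (simp add: circle_point_def)
    then show ?thesis using p by (intro heq[where q = "p t"]) (auto simp: h_def)
  qed
  have cont: "continuous_on UNIV h"
  proof -
    \<comment> \<open>Points of the section have norm below 1, so the support function is
      1-Lipschitz in the direction.\<close>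
    have le: "h s - h t \<le> norm (?u s - ?u t)" for s t
    proof -
      have "h s - h t \<le> (?u s - ?u t) \<bullet> p s"
        using p(2)[OF p(1)[of s], of t] by (simp add: h_def inner_diff_left)
      also have "\<dots> \<le> norm (?u s - ?u t) * norm (p s)" by (rule norm_cauchy_schwarz)
      also have "\<dots> \<le> norm (?u s - ?u t) * 1"
        using nQ[OF p(1)[of s]] by (intro mult_left_mono) auto
      finally show ?thesis by simp
    qed
    have "isCont h t" for t
    proof -
      have "((\<lambda>s. norm (?u s - ?u t)) \<longlongrightarrow> norm (?u t - ?u t)) (at t)"
        unfolding circle_point_def by (intro tendsto_intros)
      then have "((\<lambda>s. norm (?u s - ?u t)) \<longlongrightarrow> 0) (at t)" by simp
      then have "((\<lambda>s. h s - h t) \<longlongrightarrow> 0) (at t)"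
        by (rule Lim_null_comparison[rotated])
          (use le[of _ t] le[of t] in \<open>auto intro!: always_eventually simp: abs_le_iff norm_minus_commute[of "?u t"]\<close>)
      then show ?thesis by (simp add: isCont_def LIM_zero_cancel)
    qed
    then show ?thesis by (simp add: continuous_on_eq_continuous_at)
  qed
  have rot: "h (t + (pi - 2 * arccos (h t))) = h t" for t
  proof -
    \<comment> \<open>The supporting line \<open>?u t \<bullet> y = cos c\<close> meets the unit
      circle at the angles \<open>t - c\<close> and \<open>t + c\<close>; the apex \<open>x\<close>
      is the first of these. In the frame \<open>x\<close>, \<open>e\<close> the normal
      \<open>?u t\<close> has angle \<open>c\<close>, so the slope of this line from
      \<open>x\<close> is \<open>cos c / sin c\<close>.\<close>
    define c where "c = arccos (h t)"
    have c: "cos c = h t" "0 < c" "c < pi / 2" 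
      using bd[of t] arccos_lt_bounded[of "h t"] arccos_less_arccos[of 0 "h t"]
      by (auto simp: c_def)
    have sc: "sin c > 0" "cos c > 0" using c bd[of t] by (auto intro: sin_gt_zero)
    define x e where "x = ?u (t - c)" and "e = ?u (t - c + pi / 2)"
    have on: "norm x = 1" "norm e = 1" "x \<bullet> e = 0"
      by (auto simp: x_def e_def nu ip cos_diff)
    have sp: "span {x, e} = span {a, b}" unfolding x_def e_def by (rule span_circle_points)
    have u1: "?u t \<bullet> y = cos c * (x \<bullet> y) + sin c * (e \<bullet> y)" for y
    proof -
      have "?u t = circle_point x e c"
        unfolding x_def e_def circle_point_rotate by simp
      then show ?thesis by (simp add: inner_add_left circle_point_def[of x e])
    qed
    \<comment> \<open>In the frame \<open>x\<close>, \<open>e\<close> this direction has angle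
      \<open>pi - c\<close>: it is the mirror image of \<open>?u t\<close> under
      \<open>x \<mapsto> - x\<close>, hence normal to the line of slope \<open>cos c / sin c\<close>
      through \<open>- x\<close>.\<close>
    have u2: "?u (t + (pi - 2 * c)) \<bullet> y = sin c * (e \<bullet> y) - cos c * (x \<bullet> y)" for y
    proof -
      have "?u (t + (pi - 2 * c)) = circle_point x e (pi - c)"
        unfolding x_def e_def circle_point_rotate by (simp add: algebra_simps)
      then show ?thesis by (simp add: inner_diff_left circle_point_def[of x e])
    qed
    have lt: "x \<bullet> y < 1" if "y \<in> Q" for y
      using norm_cauchy_schwarz[of x y] nQ[OF that] on by simp
    have A: "supporting_slope K x e (cos c / sin c)"
      unfolding supporting_slope_def sp Q_def[symmetric]
    proof (intro conjI ballI bexI[of _ "p t"])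
      show "e \<bullet> p t = cos c / sin c * (1 - x \<bullet> p t)"
        using u1[of "p t"] c(1) sc by (simp add: h_def field_simps)
      show "e \<bullet> y \<le> cos c / sin c * (1 - x \<bullet> y)" if "y \<in> Q" for y
        using u1[of y] p(2)[OF that, of t] c(1) sc by (simp add: h_def field_simps)
    qed (use lt p in auto)
    obtain B where B: "supporting_slope K (- x) e B"
      using supporting_slope_exists[OF K(1,2), of "- x" e] on(1) dQ
      by (auto simp: span_pair_eqs sp Q_def)
    have "e \<bullet> y \<le> B * (1 + x \<bullet> y)" if "y \<in> Q" for y
      using B that by (auto simp: supporting_slope_def span_pair_eqs sp Q_def)
    \<comment> \<open>The point \<open>d *\<^sub>R e\<close> of the section has
      \<open>x\<close>-coordinate 0, which gives \<open>d \<le> B\<close>.\<close>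
    from this[OF dQ[of "t - c + pi / 2", folded e_def]]
    have "B > 0" using on d(1) by (simp add: dot_square_norm)
    have "cos c / sin c = B"
      using supporting_slopes_eq[OF on perp[OF on(1)] A] B \<open>B > 0\<close> sc by (simp add: add_pos_pos)
    with B obtain q where q: "q \<in> Q" "e \<bullet> q = cos c / sin c * (1 + x \<bullet> q)"
      and Q_le: "\<And>y. y \<in> Q \<Longrightarrow> e \<bullet> y \<le> cos c / sin c * (1 + x \<bullet> y)"
      by (auto simp: supporting_slope_def span_pair_eqs sp Q_def)
    \<comment> \<open>Multiplied by \<open>sin c\<close>, the slope bound at \<open>- x\<close>
      becomes a support inequality with the same value \<open>cos c\<close>, attained at
      \<open>q\<close>.\<close>
    have "h (t + (pi - 2 * c)) = cos c"
    proof (rule heq)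
      show "?u (t + (pi - 2 * c)) \<bullet> y \<le> cos c" if "y \<in> Q" for y
        unfolding u2 using Q_le[OF that] sc by (simp add: field_simps)
      show "?u (t + (pi - 2 * c)) \<bullet> q = cos c"
        unfolding u2 using q(2) sc by (simp add: field_simps)
    qed fact
    then show ?thesis by (simp add: c_def[symmetric] c(1))
  qed
  \<comment> \<open>From here on \<open>c\<close> is the radius, no longer an angle.\<close>
  define c where "c = h 0"
  have hc: "h t = c" for t
    unfolding c_def by (rule continuous_rotation_invariant_imp_constant[OF cont per bd rot])
  have polar: "\<exists>t. u = ?u t" if "norm u = 1" "u \<in> span {a, b}" for u
  proof -
    have u: "u = (a \<bullet> u) *\<^sub>R a + (b \<bullet> u) *\<^sub>R b"
      by (rule orthonormal_pair_expansion[OF ab that(2)])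
    have "u \<bullet> u = (a \<bullet> u)\<^sup>2 + (b \<bullet> u)\<^sup>2"
      by (subst (2) u) (simp add: inner_add_right inner_commute power2_eq_square)
    then have "(a \<bullet> u)\<^sup>2 + (b \<bullet> u)\<^sup>2 = 1" using that(1) by (simp add: dot_square_norm)
    then obtain t where "a \<bullet> u = cos t" "b \<bullet> u = sin t" by (rule sincos_total_2pi)
    with u show ?thesis by (auto simp: circle_point_def)
  qed
  have c: "c > 0" using bd[of 0] by (simp add: c_def)
  have le: "norm y \<le> c" if "y \<in> Q" for y
  proof (cases "y = 0")
    case False
    then have "norm (sgn y) = 1" "sgn y \<in> span {a, b}"
      using that by (auto simp: norm_sgn Q_def sgn_div_norm intro: span_scale)
    then obtain t where t: "sgn y = ?u t" using polar by blast
    have "norm y = sgn y \<bullet> y"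
      using False by (simp add: sgn_div_norm dot_square_norm power2_eq_square)
    also have "\<dots> \<le> c" using p(2)[OF that, of t] hc[of t] by (simp add: t h_def)
    finally show ?thesis .
  qed (use c in simp)
  show thesis
  proof (rule that[OF c])
    show "norm y \<le> c" if "y \<in> K" "y \<in> span {a, b}" for y using le that by (simp add: Q_def)
    show "c *\<^sub>R u \<in> K" if u: "norm u = 1" "u \<in> span {a, b}" for u
    proof -
      obtain t where t: "u = ?u t" using polar u by blast
      have "u \<bullet> p t = c" using hc[of t] by (simp add: h_def t)
      \<comment> \<open>Equality case of Cauchy-Schwarz: a maximiser in direction \<open>u\<close>
        with norm at most \<open>c\<close> can only be \<open>c *\<^sub>R u\<close>.\<close>
      then have "(norm (p t - c *\<^sub>R u))\<^sup>2 = (norm (p t))\<^sup>2 - c\<^sup>2"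
        using u(1) unfolding power2_norm_eq_inner
        by (simp add: inner_diff_left inner_diff_right inner_commute[of "p t" u] norm_eq_1 power2_eq_square)
      also have "\<dots> \<le> 0" using le[OF p(1)[of t]] by (simp add: power_mono)
      finally have "p t = c *\<^sub>R u" by simp
      with p(1)[of t] show ?thesis by (simp add: Q_def)
    qed
  qed
qed

section \<open>Gluing the planar discs into a ball\<close>

theorem theorem2:
  fixes K :: "(real ^ 'n) set"
  assumes "CARD('n) \<ge> 2"
    and "convex_body K"
    and "K \<subseteq> interior (cball 0 1)"
    and "\<And>x. x \<in> sphere 0 1 \<Longrightarrow>
           support_cone K x \<inter> support_cone K (- x) \<subseteq> {y. x \<bullet> y = 0}"
  shows "\<exists>c r. r > 0 \<and> K = cball c r"
proof -
  have dim: "DIM(real ^ 'n) \<ge> 2" using assms(1) by simp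
  have K: "compact K" "convex K" "K \<subseteq> ball 0 1"
    using assms(2,3) by (auto simp: convex_body_def interior_cball)
  have perp: "support_cone K x \<inter> support_cone K (- x) \<subseteq> {y. x \<bullet> y = 0}" if "norm x = 1" for x
    using assms(4)[of x] that by simp
  have int: "0 \<in> interior K"
    by (rule zero_in_interior[OF dim assms(2) K(3) perp])
  \<comment> \<open>Both directions lie in one plane, whose section is a disc, so \<open>K\<close>
    reaches equally far along them. Comparing each direction with a fixed \<open>a\<close> then
    yields a common radius \<open>r\<close>.\<close>
  have pair: "\<exists>c>0. \<forall>w \<in> {u, v}. c *\<^sub>R w \<in> K \<and> (\<forall>l. l *\<^sub>R w \<in> K \<longrightarrow> l \<le> c)"
    if uv: "norm u = 1" "norm v = 1" for u v
  proof -
    obtain w where w: "norm w = 1" "u \<bullet> w = 0" "v \<in> span {u, w}"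
      using orthonormal_partner_exists[OF dim uv(1)] .
    obtain c where c: "c > 0"
      "\<And>z. norm z = 1 \<Longrightarrow> z \<in> span {u, w} \<Longrightarrow> c *\<^sub>R z \<in> K"
      "\<And>y. y \<in> K \<Longrightarrow> y \<in> span {u, w} \<Longrightarrow> norm y \<le> c"
      by (rule section_is_disc[OF K(1,3) int perp uv(1) w(1,2)]) blast+
    have "c *\<^sub>R z \<in> K \<and> (\<forall>l. l *\<^sub>R z \<in> K \<longrightarrow> l \<le> c)" if "z \<in> {u, v}" for z
    proof -
      have z: "norm z = 1" "z \<in> span {u, w}" using that uv w(3) by (auto intro: span_base)
      have "l \<le> c" if "l *\<^sub>R z \<in> K" for l
        using c(3)[OF that span_scale[OF z(2)]] z(1) by simp
      with c(2)[OF z] show ?thesis by blast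
    qed
    with c(1) show ?thesis by blast
  qed
  obtain a :: "real ^ 'n" where a: "norm a = 1" by (rule vector_choose_size[of 1]) auto
  obtain r where r: "r > 0" "r *\<^sub>R a \<in> K" "\<And>l. l *\<^sub>R a \<in> K \<Longrightarrow> l \<le> r"
    using pair[OF a a] by auto
  have radial: "r *\<^sub>R u \<in> K" "l *\<^sub>R u \<in> K \<Longrightarrow> l \<le> r" if u: "norm u = 1" for u l
  proof -
    obtain c where c: "c *\<^sub>R a \<in> K" "\<And>l. l *\<^sub>R a \<in> K \<Longrightarrow> l \<le> c"
      "c *\<^sub>R u \<in> K" "\<And>l. l *\<^sub>R u \<in> K \<Longrightarrow> l \<le> c"
      using pair[OF a u] by auto
    have "c = r" using r c by (intro antisym)
    with c show "r *\<^sub>R u \<in> K" "l *\<^sub>R u \<in> K \<Longrightarrow> l \<le> r" by auto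
  qed
  have "y \<in> K \<longleftrightarrow> norm y \<le> r" for y
  proof (cases "y = 0")
    case True
    then show ?thesis using r(1) int interior_subset by auto
  next
    case False
    then have s: "norm (sgn y) = 1" "norm y *\<^sub>R sgn y = y" by (auto simp: norm_sgn sgn_div_norm)
    show ?thesis
    proof
      assume "y \<in> K"
      with radial(2)[OF s(1), of "norm y"] s(2) show "norm y \<le> r" by simp
    next
      assume "norm y \<le> r"
      \<comment> \<open>A convex combination of the origin and the boundary point in the direction
        of \<open>y\<close>.\<close>
      moreover have "y = (1 - norm y / r) *\<^sub>R 0 + (norm y / r) *\<^sub>R (r *\<^sub>R sgn y)"
        using r(1) s(2) by simp
      ultimately show "y \<in> K"
        using convexD_alt[OF K(2), of 0 "r *\<^sub>R sgn y" "norm y / r"] radial(1)[OF s(1)] r(1) int interior_subset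
        by (auto simp: field_simps)
    qed
  qed
  then have "K = cball 0 r" by (intro set_eqI) simp
  with r(1) show ?thesis by blast
qed

end
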